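(* Let $G \leq \mathrm{Sym}(n)$ be a finite permutation group such that $\Sigma_G$ has the $k$-local-global property, and let $\mathcal C$ be a closed oligomorphic clone on a countable set $A$. Then $\mathcal C$ satisfies $\Sigma_G$ if and only if $\mathcal C$ satisfies $\Sigma_{G}$ on every subset $F \subseteq A^n$ with $|F|=k$.
   Context: An algebra $\mathbf{A} = (A,(f_i)_{i\in I})$ is a non-empty set $A$ with a list of finitary operations. $\mathsf{Clo}(\mathbf A)$ is the set (clone) of term operations of $\mathbf A$, i.e. all operations obtained by composing basic operations and projections. A clone on $A$ is a set of finitary operations on $A$ containing all projections and closed under composition. For $G \leq \mathrm{Sym}(n)$ and $t\colon A^n\to A$, write $t^\pi(x_1,\dots,x_n) = t(x_{\pi(1)},\dots,x_{\pi(n)})$. $\Sigma_G$ is the set of all identities $t\approx t^\pi$, $\pi\in G$, in one $n$-ary function symbol $t$. A clone $\mathcal C$ on $A$ satisfies $\Sigma_G$ if there is an $n$-ary $t\in\mathcal C$ with $t(\overline x)=t^\pi(\overline x)$ for all $\pi\in G$ and $\overline x\in A^n$; it satisfies $\Sigma_G$ on $F\subseteq A^n$ if there is an $n$-ary $t\in\mathcal C$ with $t(\overline x)=t^\pi(\overline x)$ for all $\pi\in G$ and $\overline x\in F$. An algebra $\mathbf A$ satisfies $\Sigma_G$ (on $F$) if $\mathsf{Clo}(\mathbf A)$ does. For $k\ge 1$, $\Sigma_G$ has the $k$-local-global property if every algebra $\mathbf A$ such that $|A|^{n}\geq k$ and $\mathbf A$ satisfies $\Sigma_G$ on all $k$-element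 sets $F\subseteq A^{n}$ satisfies $\Sigma_G$ on every finite subset of $A^{n}$. A clone $\mathcal C$ on a countably infinite set $A$ is oligomorphic if the group $\mathcal C^{inv}$ of its unary invertible elements (bijections $f\colon A\to A$ in $\mathcal C$ whose inverse is also in $\mathcal C$) is an oligomorphic permutation group, i.e. its componentwise action on $A^m$ has only finitely many orbits for every $m\in\mathbb N$. A clone is closed if it is closed in the topology of pointwise convergence, in which a sequence $(f_i)_{i\in\mathbb N}$ converges to $f$ iff all $f_i$ and $f$ have the same arity $m$ and for every finite $F\subseteq A^m$, $f|_F=f_i|_F$ for all big enough $i$. *)

theory Defs
  imports
    "HOL-Analysis.Sum_Topology"
    "HOL-Analysis.Function_Topology"
    "HOL-Algebra.Sym_Groups"
    "HOL-Algebra.Group_Action"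
begin

definition tuples :: "'a set \<Rightarrow> nat \<Rightarrow> (nat \<Rightarrow> 'a) set" where
  "tuples A n = ({1..n} \<rightarrow>\<^sub>E A)"

(* An operation carries its arity explicitly: extensional functions of different arities
   may be equal as HOL functions (e.g. on A = {undefined}). Arity 0 is allowed. *)
type_synonym 'a operation = "nat \<times> ((nat \<Rightarrow> 'a) \<Rightarrow> 'a)"

definition operations :: "'a set \<Rightarrow> 'a operation set" where
  "operations A = (SIGMA n:UNIV. tuples A n \<rightarrow>\<^sub>E A)"

definition projection :: "'a set \<Rightarrow> nat \<Rightarrow> nat \<Rightarrow> (nat \<Rightarrow> 'a) \<Rightarrow> 'a" where
  "projection A n i = (\<lambda>x\<in>tuples A n. x i)"

definition composition ::
  "'a set \<Rightarrow> nat \<Rightarrow> nat \<Rightarrow> ((nat \<Rightarrow> 'a) \<Rightarrow> 'a) \<Rightarrow> (nat \<Rightarrow> (nat \<Rightarrow> 'a) \<Rightarrow> 'a) \<Rightarrow> (nat \<Rightarrow> 'a) \<Rightarrow> 'a" where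
  "composition A m n f g = (\<lambda>x\<in>tuples A n. f (\<lambda>i\<in>{1..m}. g i x))"

definition is_clone :: "'a set \<Rightarrow> 'a operation set \<Rightarrow> bool" where
  "is_clone A C \<longleftrightarrow>
     C \<subseteq> operations A \<and>
     (\<forall>n. \<forall>i\<in>{1..n}. (n, projection A n i) \<in> C) \<and>
     (\<forall>m n f g. (m, f) \<in> C \<longrightarrow> (\<forall>i\<in>{1..m}. (n, g i) \<in> C) \<longrightarrow> (n, composition A m n f g) \<in> C)"

(* An algebra is given by its universe and the set of its basic operations; an indexed
   family of basic operations enters below only through its range, via the term operations. *)
definition is_algebra :: "'a set \<Rightarrow> 'a operation set \<Rightarrow> bool" where
  "is_algebra A B \<longleftrightarrow> A \<noteq> {} \<and> B \<subseteq> operations A"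

inductive_set Clo :: "'a set \<Rightarrow> 'a operation set \<Rightarrow> 'a operation set"
  for A :: "'a set" and B :: "'a operation set" where
  basic: "(n, f) \<in> B \<Longrightarrow> (n, f) \<in> Clo A B"
| proj: "i \<in> {1..n} \<Longrightarrow> (n, projection A n i) \<in> Clo A B"
| comp: "(m, f) \<in> Clo A B \<Longrightarrow> (\<And>i. i \<in> {1..m} \<Longrightarrow> (n, g i) \<in> Clo A B)
    \<Longrightarrow> (n, composition A m n f g) \<in> Clo A B"

(* If p permutes {1..n} and x is in tuples A n, then so is x \<circ> p. *)
definition permute_args :: "(nat \<Rightarrow> nat) \<Rightarrow> ((nat \<Rightarrow> 'a) \<Rightarrow> 'a) \<Rightarrow> (nat \<Rightarrow> 'a) \<Rightarrow> 'a" where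
  "permute_args p t = (\<lambda>x. t (x \<circ> p))"

definition satisfies_Sigma_on ::
  "'a operation set \<Rightarrow> nat \<Rightarrow> (nat \<Rightarrow> nat) set \<Rightarrow> (nat \<Rightarrow> 'a) set \<Rightarrow> bool" where
  "satisfies_Sigma_on C n G F \<longleftrightarrow>
     (\<exists>t. (n, t) \<in> C \<and> (\<forall>p\<in>G. \<forall>x\<in>F. t x = permute_args p t x))"

definition satisfies_Sigma ::
  "'a set \<Rightarrow> 'a operation set \<Rightarrow> nat \<Rightarrow> (nat \<Rightarrow> nat) set \<Rightarrow> bool" where
  "satisfies_Sigma A C n G \<longleftrightarrow>
     (\<exists>t. (n, t) \<in> C \<and> (\<forall>p\<in>G. \<forall>x\<in>tuples A n. t x = permute_args p t x))"

(* The k-local-global property for all algebras whose universe is an arbitrary non-empty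
   subset of the type 'a; HOL cannot quantify over the type itself. If 'a is infinite, this
   is equivalent to the property for all algebras: for n \<ge> 1, every counterexample yields one
   with a countable universe, by closing a finite set on which Sigma_G fails under countably
   many term operations that witness Sigma_G on the k-element sets.
   The first disjunct of the size condition is needed since card is 0 on infinite sets. *)
definition local_global :: "'a itself \<Rightarrow> nat \<Rightarrow> nat \<Rightarrow> (nat \<Rightarrow> nat) set \<Rightarrow> bool" where
  "local_global (_ :: 'a itself) k n G \<longleftrightarrow>
     (\<forall>(A :: 'a set) B.
        is_algebra A B \<longrightarrow>
        infinite (tuples A n) \<or> card (tuples A n) \<ge> k \<longrightarrow>
        (\<forall>F. F \<subseteq> tuples A n \<and> finite F \<and> card F = k \<longrightarrow> satisfies_Sigma_on (Clo A B) n G F) \<longrightarrow>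
        (\<forall>F. F \<subseteq> tuples A n \<and> finite F \<longrightarrow> satisfies_Sigma_on (Clo A B) n G F))"

definition unary_operation :: "'a set \<Rightarrow> ('a \<Rightarrow> 'a) \<Rightarrow> 'a operation" where
  "unary_operation A f = (1, \<lambda>x\<in>tuples A 1. f (x 1))"

definition clone_inv :: "'a set \<Rightarrow> 'a operation set \<Rightarrow> ('a \<Rightarrow> 'a) set" where
  "clone_inv A C =
     {f \<in> Bij A. unary_operation A f \<in> C \<and> unary_operation A (\<lambda>y\<in>A. inv_into A f y) \<in> C}"

definition oligomorphic_group :: "'a set \<Rightarrow> ('a \<Rightarrow> 'a) set \<Rightarrow> bool" where
  "oligomorphic_group A H \<longleftrightarrow>
     subgroup H (BijGroup A) \<and>
     (\<forall>m. finite (orbits (BijGroup A\<lparr>carrier := H\<rparr>) (tuples A m) (\<lambda>f x. \<lambda>i\<in>{1..m}. f (x i))))"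

definition oligomorphic_clone :: "'a set \<Rightarrow> 'a operation set \<Rightarrow> bool" where
  "oligomorphic_clone A C \<longleftrightarrow>
     is_clone A C \<and> countable A \<and> infinite A \<and> oligomorphic_group A (clone_inv A C)"

(* Pointwise convergence on the n-ary operations is the product topology with A discrete;
   operations of different arities lie in different summands. *)
definition operation_topology :: "'a set \<Rightarrow> 'a operation topology" where
  "operation_topology A =
     sum_topology (\<lambda>n. product_topology (\<lambda>_. discrete_topology A) (tuples A n)) UNIV"

definition closed_clone :: "'a set \<Rightarrow> 'a operation set \<Rightarrow> bool" where
  "closed_clone A C \<longleftrightarrow> is_clone A C \<and> closedin (operation_topology A) C"

end

theory Submission
  imports Defs "HOL-Analysis.Finite_Cartesian_Product"
begin

text \<open>
  Identities that hold locally hold globally by compactness. A clone is closed under its own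
  term operations, so the local-global property applies to the algebra whose basic
  operations are all of \<open>C\<close> and yields, for every finite set of tuples, an operation in
  \<open>C\<close> that is \<open>G\<close>-invariant on that set. These operations for larger and larger finite sets
  need not converge, and \<open>A\<close> is infinite, so their values at a single tuple may take
  infinitely many values. Oligomorphicity repairs this: composing with an invertible
  unary operation of \<open>C\<close> from the left keeps all identities \<open>t \<approx> t\<^sup>\<pi>\<close> that the
  operation satisfies, and up to such compositions there are only finitely many
  possibilities for the values at any \<open>m\<close> given tuples.

  Enumerate the tuples as \<open>e 0, e 1, \<dots>\<close>. Call a list of prescribed values at the first \<open>m\<close>
  tuples admissible if for every \<open>N\<close> some operation in \<open>C\<close> takes these values and is
  \<open>G\<close>-invariant on the first \<open>N\<close> tuples. The empty list is admissible, and the pigeonhole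
  principle on orbits extends an admissible list by one further value
  (\<open>symmetric_operation_extend_values\<close>). The limit of these lists is an operation that
  agrees on every finite set with an operation in \<open>C\<close> that is \<open>G\<close>-invariant there. So it is in \<open>C\<close>, which is closed, and it is
  \<open>G\<close>-invariant everywhere, since each instance of an identity involves two tuples only.
\<close>

section \<open>Clones and permuted tuples\<close>

lemma Clo_eq_clone:
  assumes "is_clone A C"
  shows "Clo A C = C"
proof -
  have "(n, f) \<in> C" if "(n, f) \<in> Clo A C" for n f
    using that
  proof (induction rule: Clo.induct)
    case (comp m f n g)
    then show ?case using assms unfolding is_clone_def by blast
  qed (use assms in \<open>auto simp: is_clone_def\<close>)
  then show ?thesis by (auto intro: Clo.basic)
qed

lemma clone_operation:
  assumes "is_clone A C" "(n, t) \<in> C"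
  shows "t \<in> tuples A n \<rightarrow>\<^sub>E A"
  using assms unfolding is_clone_def operations_def by auto

lemma clone_left_composition:
  assumes "is_clone A C" "unary_operation A f \<in> C" "(n, t) \<in> C"
  shows "(n, \<lambda>x\<in>tuples A n. f (t x)) \<in> C"
proof -
  have "(n, composition A 1 n (\<lambda>x\<in>tuples A 1. f (x 1)) (\<lambda>_. t)) \<in> C"
  proof -
    have "(m, h) \<in> C \<Longrightarrow> (\<forall>i\<in>{1..m}. (n, g i) \<in> C) \<Longrightarrow> (n, composition A m n h g) \<in> C"
      for m h g
      using assms(1) unfolding is_clone_def by blast
    then show ?thesis using assms(2,3) unfolding unary_operation_def by simp
  qed
  moreover have "composition A 1 n (\<lambda>x\<in>tuples A 1. f (x 1)) (\<lambda>_. t)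
      = (\<lambda>x\<in>tuples A n. f (t x))"
    using clone_operation[OF assms(1,3)]
    by (auto simp: composition_def tuples_def fun_eq_iff restrict_def PiE_iff extensional_def)
  ultimately show ?thesis by simp
qed

lemma tuples_comp_permutes:
  assumes "p permutes {1..n}" "x \<in> tuples A n"
  shows "x \<circ> p \<in> tuples A n"
  using assms permutes_in_image[OF assms(1)] permutes_not_in[OF assms(1)]
  by (auto simp: tuples_def PiE_iff extensional_def)

lemma infinite_tuples:
  assumes "infinite A" "n \<ge> 1"
  shows "infinite (tuples A n)"
proof
  assume "finite (tuples A n)"
  moreover have "(\<lambda>x. x 1) ` tuples A n = A"
  proof
    show "A \<subseteq> (\<lambda>x. x 1) ` tuples A n"
    proof
      fix a assume "a \<in> A"
      then have "(\<lambda>i\<in>{1..n}. a) \<in> tuples A n" "(\<lambda>i\<in>{1..n}. a) 1 = a"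
        using assms(2) by (auto simp: tuples_def)
      then show "a \<in> (\<lambda>x. x 1) ` tuples A n" by (metis imageI)
    qed
  qed (use assms(2) in \<open>auto simp: tuples_def\<close>)
  ultimately show False using assms(1) by (metis finite_imageI)
qed

section \<open>Closedness and finite interpolation\<close>

text \<open>
  A basic neighbourhood in the topology of pointwise convergence constrains only finitely many
  arguments, so an operation that \<open>C\<close> interpolates on every finite set is in the closure of \<open>C\<close>.
\<close>
lemma closed_clone_interpolation:
  assumes "closed_clone A C" and t: "t \<in> tuples A n \<rightarrow>\<^sub>E A"
    and interp: "\<And>F. finite F \<Longrightarrow> F \<subseteq> tuples A n \<Longrightarrow> \<exists>s. (n, s) \<in> C \<and> (\<forall>x\<in>F. s x = t x)"
  shows "(n, t) \<in> C"
proof (rule ccontr)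
  assume notin: "(n, t) \<notin> C"
  let ?P = "\<lambda>n. product_topology (\<lambda>_. discrete_topology A) (tuples A n)"
  let ?O = "operation_topology A"
  have cl: "is_clone A C" and "closedin ?O C"
    using assms(1) by (auto simp: closed_clone_def)
  then have "openin ?O (topspace ?O - C)" by blast
  then have "openin (?P n) {f. (n, f) \<in> topspace ?O - C}"
    unfolding operation_topology_def openin_sum_topology by (auto simp: vimage_def)
  moreover have "t \<in> {f. (n, f) \<in> topspace ?O - C}"
    using t notin by (auto simp: operation_topology_def)
  ultimately obtain U where fin: "finite {x \<in> tuples A n. U x \<noteq> A}"
    and tU: "t \<in> Pi\<^sub>E (tuples A n) U"
    and UC: "Pi\<^sub>E (tuples A n) U \<subseteq> {f. (n, f) \<in> topspace ?O - C}"
    unfolding openin_product_topology_alt by (auto simp: Ball_def)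
  obtain s where s: "(n, s) \<in> C" "\<forall>x\<in>{x \<in> tuples A n. U x \<noteq> A}. s x = t x"
    using interp[OF fin] by auto
  have "s x \<in> U x" if "x \<in> tuples A n" for x
    using that s tU clone_operation[OF cl s(1)] by (cases "U x = A") (auto simp: PiE_iff)
  then have "s \<in> Pi\<^sub>E (tuples A n) U"
    using clone_operation[OF cl s(1)] by (auto simp: PiE_iff)
  then show False using UC s(1) by auto
qed

section \<open>Compactness from oligomorphicity\<close>

text \<open>
  Among infinitely many \<open>m\<close>-tuples infinitely many lie in one orbit, and each of these is moved
  onto a fixed representative by some element of the group.
\<close>
lemma oligomorphic_group_pigeonhole:
  assumes olig: "oligomorphic_group A H" and y: "\<And>N::nat. y N \<in> tuples A m"
  obtains M where "infinite {N. \<exists>f\<in>H. \<forall>i\<in>{1..m}. f (y N i) = y M i}"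
proof -
  let ?act = "\<lambda>f x. \<lambda>i\<in>{1..m}. f (x i)"
  let ?orb = "orbit (BijGroup A\<lparr>carrier := H\<rparr>) ?act"
  have "(\<lambda>N. ?orb (y N)) ` UNIV \<subseteq> orbits (BijGroup A\<lparr>carrier := H\<rparr>) (tuples A m) ?act"
    using y unfolding orbits_def by auto
  then have "finite ((\<lambda>N. ?orb (y N)) ` UNIV)"
    using olig unfolding oligomorphic_group_def by (meson finite_subset)
  then obtain M where M: "infinite {N. ?orb (y N) = ?orb (y M)}"
    using pigeonhole_infinite[OF infinite_UNIV_nat] by auto
  have "(\<lambda>x\<in>A. x) \<in> H"
    using olig subgroup.one_closed[of H "BijGroup A"]
    by (auto simp: oligomorphic_group_def BijGroup_def)
  moreover have "?act (\<lambda>x\<in>A. x) (y M) = y M"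
  proof
    fix i show "?act (\<lambda>x\<in>A. x) (y M) i = y M i"
      using y[of M] by (cases "i \<in> {1..m}") (auto simp: tuples_def PiE_iff extensional_def)
  qed
  ultimately have self: "y M \<in> ?orb (y M)"
    by (auto simp: orbit_def intro!: exI[of _ "\<lambda>x\<in>A. x"])
  have "\<exists>f\<in>H. \<forall>i\<in>{1..m}. f (y N i) = y M i" if "?orb (y N) = ?orb (y M)" for N
  proof -
    have "y M \<in> ?orb (y N)" using self that by simp
    then obtain f where "f \<in> H" "y M = ?act f (y N)" unfolding orbit_def by auto
    then show ?thesis by (intro bexI[of _ f]) auto
  qed
  then have "{N. ?orb (y N) = ?orb (y M)} \<subseteq> {N. \<exists>f\<in>H. \<forall>i\<in>{1..m}. f (y N i) = y M i}"
    by blast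
  then show thesis using M that infinite_super by blast
qed

text \<open>
  The inductive step of the compactness argument. The operations \<open>t N\<close> that witness the
  admissibility of \<open>a\<close> may disagree at \<open>e m\<close>. One of them, \<open>t M\<close>, is chosen so that infinitely many
  others have, on the first \<open>m + 1\<close> tuples, values in the orbit of the values of \<open>t M\<close>. Moving the
  values of these others onto those of \<open>t M\<close> gives witnesses for arbitrarily large \<open>N\<close> that all
  agree with \<open>t M\<close> at \<open>e m\<close>. On the earlier tuples \<open>t M\<close> has the values \<open>a\<close>, so nothing
  that is already prescribed changes.
\<close>
lemma symmetric_operation_extend_values:
  fixes e :: "nat \<Rightarrow> nat \<Rightarrow> 'a" and a :: "nat \<Rightarrow> 'a"
  assumes clone: "is_clone A C" and olig: "oligomorphic_group A (clone_inv A C)"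
    and perm: "\<And>p. p \<in> G \<Longrightarrow> p permutes {1..n}"
    and e: "\<And>j. e j \<in> tuples A n"
    and a: "\<And>N. \<exists>t. (n, t) \<in> C \<and> (\<forall>p\<in>G. \<forall>x\<in>e ` {..<N}. t x = permute_args p t x)
      \<and> (\<forall>j<m. t (e j) = a j)"
  shows "\<exists>b. (\<forall>j<m. b j = a j) \<and>
    (\<forall>N. \<exists>t. (n, t) \<in> C \<and> (\<forall>p\<in>G. \<forall>x\<in>e ` {..<N}. t x = permute_args p t x)
      \<and> (\<forall>j<Suc m. t (e j) = b j))"
proof -
  obtain t where tC: "\<And>N. (n, t N) \<in> C"
    and tsym: "\<And>N p x. p \<in> G \<Longrightarrow> x \<in> e ` {..<N} \<Longrightarrow> t N x = permute_args p (t N) x"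
    and ta: "\<And>N j. j < m \<Longrightarrow> t N (e j) = a j"
    using a by metis
  have tA: "t N (e j) \<in> A" for N j
    using clone_operation[OF clone tC] e by blast
  \<comment> \<open>Tuples are indexed from 1, the enumeration from 0.\<close>
  define y where "y N = (\<lambda>i\<in>{1..Suc m}. t N (e (i - 1)))" for N
  have "y N \<in> tuples A (Suc m)" for N
    using tA by (auto simp: y_def tuples_def)
  with olig obtain M
    where inf: "infinite {N. \<exists>f\<in>clone_inv A C. \<forall>i\<in>{1..Suc m}. f (y N i) = y M i}"
    using oligomorphic_group_pigeonhole by blast
  have "\<exists>s. (n, s) \<in> C \<and> (\<forall>p\<in>G. \<forall>x\<in>e ` {..<N}. s x = permute_args p s x)
      \<and> (\<forall>j<Suc m. s (e j) = t M (e j))" for N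
  proof -
    obtain N' f where N': "N < N'" and f: "f \<in> clone_inv A C"
      and fy: "\<forall>i\<in>{1..Suc m}. f (y N' i) = y M i"
      using inf unfolding infinite_nat_iff_unbounded by blast
    let ?s = "\<lambda>x\<in>tuples A n. f (t N' x)"
    have "(n, ?s) \<in> C"
      using clone_left_composition[OF clone _ tC] f by (auto simp: clone_inv_def)
    moreover have "?s x = permute_args p ?s x" if "p \<in> G" "x \<in> e ` {..<N}" for p x
    proof -
      have "x \<in> e ` {..<N'}" using that(2) N' by auto
      then have "t N' x = t N' (x \<circ> p)"
        using tsym[OF that(1)] by (simp add: permute_args_def)
      moreover have "x \<in> tuples A n" using that(2) e by auto
      ultimately show ?thesis
        using tuples_comp_permutes[OF perm[OF that(1)], of x] by (simp add: permute_args_def)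
    qed
    moreover have "?s (e j) = t M (e j)" if "j < Suc m" for j
    proof -
      have "f (y N' (Suc j)) = y M (Suc j)" using fy that by auto
      then show ?thesis using that e by (simp add: y_def)
    qed
    ultimately show ?thesis by blast
  qed
  then show ?thesis using ta by (intro exI[of _ "\<lambda>j. t M (e j)"]) blast
qed

lemma satisfies_Sigma_if_on_finite_sets:
  fixes A :: "'a set"
  assumes closed: "closed_clone A C" and olig: "oligomorphic_clone A C"
    and perm: "\<And>p. p \<in> G \<Longrightarrow> p permutes {1..n}" and n: "n \<ge> 1"
    and local: "\<And>F. finite F \<Longrightarrow> F \<subseteq> tuples A n \<Longrightarrow> satisfies_Sigma_on C n G F"
  shows "satisfies_Sigma A C n G"
proof -
  have clone: "is_clone A C" and A: "countable A" "infinite A"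
    and oligG: "oligomorphic_group A (clone_inv A C)"
    using olig by (auto simp: oligomorphic_clone_def)
  have "countable (tuples A n)" "infinite (tuples A n)"
    using A n infinite_tuples by (auto simp: tuples_def intro!: countable_PiE)
  then obtain e :: "nat \<Rightarrow> nat \<Rightarrow> 'a" where e: "bij_betw e UNIV (tuples A n)"
    using bij_betw_from_nat_into by blast
  have e_in: "e j \<in> tuples A n" for j using e by (auto simp: bij_betw_def)
  have e_inj: "inj e" using e by (auto simp: bij_betw_def)
  have e_surj: "\<exists>j. x = e j" if "x \<in> tuples A n" for x
    using e that by (auto simp: bij_betw_def)
  define ok where "ok m a \<longleftrightarrow> (\<forall>N. \<exists>t. (n, t) \<in> C
      \<and> (\<forall>p\<in>G. \<forall>x\<in>e ` {..<N}. t x = permute_args p t x)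
      \<and> (\<forall>j<m. t (e j) = a j))" for m and a :: "nat \<Rightarrow> 'a"
  have ok0: "\<exists>a. ok 0 a"
  proof -
    have "\<exists>t. (n, t) \<in> C \<and> (\<forall>p\<in>G. \<forall>x\<in>e ` {..<N}. t x = permute_args p t x)" for N
      using local[of "e ` {..<N}"] e_in by (auto simp: satisfies_Sigma_on_def)
    then show ?thesis by (simp add: ok_def)
  qed
  have okS: "\<exists>b. ok (Suc m) b \<and> (\<forall>j<m. b j = a j)" if "ok m a" for m a
  proof -
    have "\<exists>b. (\<forall>j<m. b j = a j) \<and> ok (Suc m) b"
      unfolding ok_def
    proof (rule symmetric_operation_extend_values[OF clone oligG perm e_in])
      show "\<exists>t. (n, t) \<in> C \<and> (\<forall>p\<in>G. \<forall>x\<in>e ` {..<N}. t x = permute_args p t x)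
          \<and> (\<forall>j<m. t (e j) = a j)" for N
        using that unfolding ok_def by (rule spec)
    qed
    then show ?thesis by blast
  qed
  obtain a where a_ok: "\<And>m. ok m (a m)" and a_ext: "\<And>m. \<forall>j<m. a (Suc m) j = a m j"
    using dependent_nat_choice[of ok "\<lambda>m a b. \<forall>j<m. b j = a j"] ok0 okS by metis
  have a_stable: "a m j = a (Suc j) j" if "j < m" for m j
    using that
  proof (induction m)
    case (Suc m)
    then show ?case using a_ext by (cases "j = m") auto
  qed simp
  \<comment> \<open>The value at \<open>e j\<close> is prescribed from stage \<open>j + 1\<close> on; \<open>t\<close> is the diagonal limit.\<close>
  define t where "t = (\<lambda>x\<in>tuples A n. let j = the_inv e x in a (Suc j) j)"
  have t_e: "t (e j) = a (Suc j) j" for j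
    using e_in e_inj by (simp add: t_def the_inv_f_f)
  have approx: "\<exists>s. (n, s) \<in> C \<and> (\<forall>p\<in>G. \<forall>x\<in>e ` {..<m}. s x = permute_args p s x)
      \<and> (\<forall>j<m. s (e j) = t (e j))" for m
    using a_ok[of m] a_stable unfolding ok_def t_e by metis
  have "t \<in> tuples A n \<rightarrow>\<^sub>E A"
  proof
    fix x assume "x \<in> tuples A n"
    then obtain j where j: "x = e j" using e_surj by blast
    obtain s where "(n, s) \<in> C" "s (e j) = t (e j)" using approx[of "Suc j"] by auto
    then show "t x \<in> A" using clone_operation[OF clone] e_in j by (metis PiE_mem)
  qed (simp add: t_def)
  moreover have "\<exists>s. (n, s) \<in> C \<and> (\<forall>x\<in>F. s x = t x)"
    if F: "finite F" "F \<subseteq> tuples A n" for F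
  proof -
    obtain m where "the_inv e ` F \<subseteq> {..<m}"
      using F(1) by (meson finite_imageI finite_nat_iff_bounded)
    then have "\<forall>x\<in>F. \<exists>j<m. x = e j"
      using F(2) e_surj e_inj by (metis image_subset_iff lessThan_iff subset_eq the_inv_f_f)
    then show ?thesis using approx[of m] by metis
  qed
  ultimately have "(n, t) \<in> C" using closed_clone_interpolation[OF closed] by blast
  moreover have "t x = permute_args p t x" if p: "p \<in> G" and x: "x \<in> tuples A n" for p x
  proof -
    obtain i j where i: "x = e i" and j: "x \<circ> p = e j"
      using e_surj x tuples_comp_permutes[OF perm[OF p] x] by metis
    \<comment> \<open>A stage beyond both indices sees \<open>x\<close> as well as \<open>x \<circ> p\<close>.\<close>
    obtain s where "\<forall>p\<in>G. \<forall>x\<in>e ` {..<Suc (max i j)}. s x = permute_args p s x"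
      and s: "\<forall>l<Suc (max i j). s (e l) = t (e l)"
      using approx by blast
    then have "s x = s (x \<circ> p)" using p i by (auto simp: permute_args_def)
    then show ?thesis using s i j by (simp add: permute_args_def less_Suc_eq_le)
  qed
  ultimately show ?thesis by (auto simp: satisfies_Sigma_def)
qed

theorem theorem19:
  fixes A :: "'a set" and C :: "'a operation set"
    and G :: "(nat \<Rightarrow> nat) set" and n k :: nat
  assumes "n \<ge> 1" and "k \<ge> 1"
    and "subgroup G (sym_group n)"
    and "local_global TYPE('a) k n G"
    and "closed_clone A C" and "oligomorphic_clone A C"
  shows "satisfies_Sigma A C n G \<longleftrightarrow>
    (\<forall>F. F \<subseteq> tuples A n \<and> finite F \<and> card F = k \<longrightarrow> satisfies_Sigma_on C n G F)"
proof
  assume "satisfies_Sigma A C n G"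
  then show "\<forall>F. F \<subseteq> tuples A n \<and> finite F \<and> card F = k \<longrightarrow> satisfies_Sigma_on C n G F"
    unfolding satisfies_Sigma_def satisfies_Sigma_on_def by blast
next
  assume k_local: "\<forall>F. F \<subseteq> tuples A n \<and> finite F \<and> card F = k \<longrightarrow> satisfies_Sigma_on C n G F"
  have clone: "is_clone A C" and A: "infinite A"
    using assms(6) by (auto simp: oligomorphic_clone_def)
  have perm: "p permutes {1..n}" if "p \<in> G" for p
    using subgroup.subset[OF assms(3)] that by (auto simp: sym_group_def)
  have "is_algebra A C"
    using A clone by (auto simp: is_algebra_def is_clone_def)
  then have "satisfies_Sigma_on C n G F" if "finite F" "F \<subseteq> tuples A n" for F
    using assms(4) k_local infinite_tuples[OF A assms(1)] that
    unfolding local_global_def by (metis Clo_eq_clone[OF clone])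
  then show "satisfies_Sigma A C n G"
    using satisfies_Sigma_if_on_finite_sets[OF assms(5,6) perm assms(1)] by blast
qed

end
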